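(* For every $n\ge 11$ with $n\equiv 3\pmod 4$ there exists an integer $9$-diagonal globally simple $\mathrm{H}_9(n;9)$ with width $\frac{n-9}{2}$.
   Context: A partially filled (p.f.) array is a matrix in which some cells may be empty. Let $n\ge k\ge 3$, let $t$ divide $2nk$, put $v=2nk+t$ and let $J$ be the subgroup of $\mathbb{Z}_v$ of order $t$. An $\mathrm{H}_t(n;k)$ (square relative Heffter array) is an $n\times n$ p.f. array with elements in $\mathbb{Z}_v$ such that each row and each column has exactly $k$ filled cells; for every $x\in\mathbb{Z}_v\setminus J$ either $x$ or $-x$ appears in the array; and the elements of every row and column sum to $0$. It is integer if moreover the elements of every row and column, viewed as integers in $\pm\{1,\dots,\lfloor\frac{2nk+t}{2}\rfloor\}$, sum to $0$ in $\mathbb{Z}$. The natural ordering of a row (column) is the ordering of its filled cells from left to right (top to bottom). An ordering $(t_1,\dots,t_\ell)$ of elements of an abelian group is simple if its partial sums $s_i=t_1+\dots+t_i$, $1\le i\le\ell$, are pairwise distinct. The array is globally simple if the natural ordering of each row and each column is simple (partial sums computed in $\mathbb{Z}_v$). For an $n\times n$ array and $i\in\{1,\dots,n\}$, the $i$-th diagonal is $D_i=\{(i,1),(i+1,2),\dots,(i-1,n)\}$, indices taken modulo $n$ in $\{1,\dots,n\}$. A p.f. array of size $n\ge k$ is $k$-diagonal if its nonempty cells are exactly those of $k$ diagonals. For a $k$-diagonal array with $n>k$, a set $\{D_{r+1},\dots,D_{r+\ell}\}$ (indices mod $n$) is an empty strip of width $\ell$ if $D_{r+1},\dots,D_{r+\ell}$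 are empty diagonals while $D_r$ and $D_{r+\ell+1}$ are filled diagonals. The array is $k$-diagonal with width $\ell$ if all its empty strips have width $\ell$. *)

theory Defs
  imports "HOL-Algebra.Elementary_Groups" "HOL-Number_Theory.Cong"
begin

(* An n x n partially filled array is a function A with cell (i, j) for i, j in {1..n}; None marks
   an empty cell and values of A outside {1..n} x {1..n} are irrelevant. *)
type_synonym 'a pf_array = "nat \<Rightarrow> nat \<Rightarrow> 'a option"

definition filled_cells :: "nat \<Rightarrow> 'a pf_array \<Rightarrow> (nat \<times> nat) set" where
  "filled_cells n A = {(i, j). i \<in> {1..n} \<and> j \<in> {1..n} \<and> A i j \<noteq> None}"

definition entries :: "nat \<Rightarrow> 'a pf_array \<Rightarrow> 'a set" where
  "entries n A = {x. \<exists>i\<in>{1..n}. \<exists>j\<in>{1..n}. A i j = Some x}"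

(* The contents of the filled cells of a row (column) in the natural ordering. *)
definition row_list :: "nat \<Rightarrow> 'a pf_array \<Rightarrow> nat \<Rightarrow> 'a list" where
  "row_list n A i = List.map_filter (\<lambda>j. A i j) [1..<Suc n]"

definition col_list :: "nat \<Rightarrow> 'a pf_array \<Rightarrow> nat \<Rightarrow> 'a list" where
  "col_list n A j = List.map_filter (\<lambda>i. A i j) [1..<Suc n]"

definition group_sum :: "('a, 'b) monoid_scheme \<Rightarrow> 'a list \<Rightarrow> 'a" where
  "group_sum G xs = foldr (\<otimes>\<^bsub>G\<^esub>) xs \<one>\<^bsub>G\<^esub>"

definition simple_ordering :: "('a, 'b) monoid_scheme \<Rightarrow> 'a list \<Rightarrow> bool" where
  "simple_ordering G xs \<longleftrightarrow> inj_on (\<lambda>i. group_sum G (take i xs)) {1..length xs}"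

definition globally_simple :: "('a, 'b) monoid_scheme \<Rightarrow> nat \<Rightarrow> 'a pf_array \<Rightarrow> bool" where
  "globally_simple G n A \<longleftrightarrow>
     (\<forall>i\<in>{1..n}. simple_ordering G (row_list n A i) \<and> simple_ordering G (col_list n A i))"

definition heffter_modulus :: "nat \<Rightarrow> nat \<Rightarrow> nat \<Rightarrow> nat" where
  "heffter_modulus t n k = 2 * n * k + t"

abbreviation heffter_group :: "nat \<Rightarrow> nat \<Rightarrow> nat \<Rightarrow> int monoid" where
  "heffter_group t n k \<equiv> integer_mod_group (heffter_modulus t n k)"

(* J is determined by its order, as a cyclic group has exactly one subgroup of each order dividing
   the order of the group. *)
definition relative_heffter :: "nat \<Rightarrow> nat \<Rightarrow> nat \<Rightarrow> int pf_array \<Rightarrow> bool" where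
  "relative_heffter t n k A \<longleftrightarrow>
     3 \<le> k \<and> k \<le> n \<and> t dvd 2 * n * k \<and>
     entries n A \<subseteq> carrier (heffter_group t n k) \<and>
     (\<forall>i\<in>{1..n}. length (row_list n A i) = k \<and> length (col_list n A i) = k) \<and>
     (\<exists>J. subgroup J (heffter_group t n k) \<and> card J = t \<and>
        (\<forall>x \<in> carrier (heffter_group t n k) - J.
           x \<in> entries n A \<or> inv\<^bsub>heffter_group t n k\<^esub> x \<in> entries n A)) \<and>
     (\<forall>i\<in>{1..n}. group_sum (heffter_group t n k) (row_list n A i) = \<one>\<^bsub>heffter_group t n k\<^esub> \<and>
                 group_sum (heffter_group t n k) (col_list n A i) = \<one>\<^bsub>heffter_group t n k\<^esub>)"

(* The representative in {-(v div 2), ..., v div 2} of a residue x in {0..<v}. The residues 0 and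
   (for even v) v / 2 have no, respectively two, representatives in +-{1, ..., v div 2}, but they lie
   in J and so never occur: the n * k filled cells must meet all n * k pairs {x, -x} outside J. *)
definition signed_rep :: "nat \<Rightarrow> int \<Rightarrow> int" where
  "signed_rep v x = (if x \<le> int (v div 2) then x else x - int v)"

definition integer_relative_heffter :: "nat \<Rightarrow> nat \<Rightarrow> nat \<Rightarrow> int pf_array \<Rightarrow> bool" where
  "integer_relative_heffter t n k A \<longleftrightarrow>
     relative_heffter t n k A \<and>
     (\<forall>i\<in>{1..n}. sum_list (map (signed_rep (heffter_modulus t n k)) (row_list n A i)) = 0 \<and>
                 sum_list (map (signed_rep (heffter_modulus t n k)) (col_list n A i)) = 0)"

(* D_i = {(i, 1), (i + 1, 2), ..., (i - 1, n)}; since a = i + b - 1 is only required modulo n, the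
   index i may be any natural number and is itself read modulo n. *)
definition diagonal :: "nat \<Rightarrow> nat \<Rightarrow> (nat \<times> nat) set" where
  "diagonal n i = {(a, b). a \<in> {1..n} \<and> b \<in> {1..n} \<and> [a + 1 = i + b] (mod n)}"

definition filled_diagonal :: "nat \<Rightarrow> 'a pf_array \<Rightarrow> nat \<Rightarrow> bool" where
  "filled_diagonal n A i \<longleftrightarrow> diagonal n i \<subseteq> filled_cells n A"

definition empty_diagonal :: "nat \<Rightarrow> 'a pf_array \<Rightarrow> nat \<Rightarrow> bool" where
  "empty_diagonal n A i \<longleftrightarrow> diagonal n i \<inter> filled_cells n A = {}"

definition k_diagonal :: "nat \<Rightarrow> nat \<Rightarrow> 'a pf_array \<Rightarrow> bool" where
  "k_diagonal n k A \<longleftrightarrow>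
     k \<le> n \<and>
     (\<exists>S. S \<subseteq> {1..n} \<and> card S = k \<and> filled_cells n A = (\<Union>i\<in>S. diagonal n i))"

(* {D_(r+1), ..., D_(r+l)} is an empty strip of width l; a strip is nonempty as a set of diagonals,
   and l < n follows since D_r is filled. *)
definition empty_strip :: "nat \<Rightarrow> 'a pf_array \<Rightarrow> nat \<Rightarrow> nat \<Rightarrow> bool" where
  "empty_strip n A r l \<longleftrightarrow>
     1 \<le> l \<and> (\<forall>i\<in>{r + 1..r + l}. empty_diagonal n A i) \<and>
     filled_diagonal n A r \<and> filled_diagonal n A (r + l + 1)"

definition k_diagonal_width :: "nat \<Rightarrow> nat \<Rightarrow> nat \<Rightarrow> 'a pf_array \<Rightarrow> bool" where
  "k_diagonal_width n k l A \<longleftrightarrow>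
     k_diagonal n k A \<and> k < n \<and> (\<forall>r\<in>{1..n}. \<forall>m. empty_strip n A r m \<longrightarrow> m = l)"

end

(* The nine filled diagonals have offsets 0, +-1, +-2, +-3, +-h with n = 2h + 1, where the offset of a
   cell is its column minus its row. For each d in {1, 2, 3, h} put b(i) in cell (i, i + d) and b(i) + K
   in cell (i + d, i): this pair of diagonals contributes b(i) + b(i - d) + K both to row i and to column
   i, so that one entry on the main diagonal corrects both sums. If b runs through n consecutive
   integers, i.e. b(i) = c + (i + t mod n) or b(i) = c + (-i mod n), the eight outer diagonals use up all
   numbers n + 1, ..., 9n + 4 that are not multiples of 2n + 1. For suitable labels the main diagonal is
   4m + 2 - 4i corrected by multiples of n (where n = 4m + 3), which takes each of the absolute values
   1, ..., n once. The signs of the outer diagonals are arranged so that crude interval bounds show that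
   no proper block of cyclically consecutive entries sums to 0 modulo 18n + 9. *)
theory Submission
  imports Defs
begin

section \<open>Circulant lists and partial sums\<close>

lemma map_filter_append:
  "List.map_filter f (xs @ ys) = List.map_filter f xs @ List.map_filter f ys"
  by (simp add: List.map_filter_def)

lemma map_filter_map: "List.map_filter f (map g xs) = List.map_filter (f \<circ> g) xs"
  by (simp add: List.map_filter_def filter_map comp_def)

lemma map_filter_cong:
  "(\<And>x. x \<in> set xs \<Longrightarrow> f x = g x) \<Longrightarrow> List.map_filter f xs = List.map_filter g xs"
  by (induction xs) (simp_all split: option.split)

text \<open>Moving the head to the end moves one surviving element or, when \<open>f\<close> drops
  the head, none; \<open>r'\<close> counts the surviving moves.\<close>

lemma map_filter_rotate:
  "\<exists>r'. List.map_filter f (rotate r xs) = rotate r' (List.map_filter f xs)"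
proof (induction r)
  case 0
  show ?case
    by (metis rotate0 id_apply)
next
  case (Suc r)
  then obtain r' where r': "List.map_filter f (rotate r xs) = rotate r' (List.map_filter f xs)"
    by blast
  show ?case
  proof (cases "rotate r xs")
    case Nil
    then show ?thesis using r' by (metis rotate_is_Nil_conv rotate_Suc rotate1.simps(1))
  next
    case (Cons y ys)
    show ?thesis
    proof (cases "f y")
      case None
      then show ?thesis using r' Cons by (auto simp: map_filter_append)
    next
      case (Some z)
      then have "List.map_filter f (rotate (Suc r) xs) = rotate (Suc r') (List.map_filter f xs)"
        using r'[symmetric] Cons by (simp add: map_filter_append)
      then show ?thesis by blast
    qed
  qed
qed

lemma map_filter_map_of_zip:
  assumes "sorted ds" "distinct ds" "set ds \<subseteq> {..<n}" "length L = length ds"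
  shows "List.map_filter (map_of (zip ds L)) [0..<n] = L"
proof -
  have dom: "map_of (zip ds L) d \<noteq> None \<longleftrightarrow> d \<in> set ds" for d
    using assms(4) by (metis map_of_zip_is_None)
  have "filter (\<lambda>d. d \<in> set ds) [0..<n] = ds"
    using assms(1-3) by (intro sorted_distinct_set_unique) (auto simp: sorted_wrt_filter)
  then have "List.map_filter (map_of (zip ds L)) [0..<n] = map (the \<circ> map_of (zip ds L)) ds"
    unfolding List.map_filter_def dom by simp
  also have "\<dots> = L"
    using assms(2,4) by (intro nth_equalityI) (auto simp: map_of_zip_nth)
  finally show ?thesis .
qed

text \<open>Reduces the natural ordering of a line to the cyclic order by offset, in which all lines
  look alike.\<close>

lemma map_filter_circulant:
  assumes "sorted ds" "distinct ds" "set ds \<subseteq> {..<n}" "length L = length ds" "a \<le> n"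
  shows "\<exists>r. List.map_filter (\<lambda>b. map_of (zip ds L) ((n + b - a) mod n)) [1..<Suc n] = rotate r L"
proof -
  \<comment> \<open>Position 1 has offset \<open>n + 1 - a\<close> modulo \<open>n\<close>, whence
    the amount of the rotation.\<close>
  have "map (\<lambda>b. (n + b - a) mod n) [1..<Suc n] = rotate (Suc n - a) [0..<n]"
    using assms(5) by (intro nth_equalityI) (auto simp: nth_rotate simp del: upt_Suc)
  then have "List.map_filter (\<lambda>b. map_of (zip ds L) ((n + b - a) mod n)) [1..<Suc n] =
      List.map_filter (map_of (zip ds L)) (rotate (Suc n - a) [0..<n])"
    by (simp add: map_filter_map comp_def del: upt_Suc flip: \<open>map _ _ = _\<close>)
  then show ?thesis
    using map_filter_rotate[of "map_of (zip ds L)" "Suc n - a" "[0..<n]"]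
    unfolding map_filter_map_of_zip[OF assms(1-4)] by simp
qed

section \<open>Residues, rotations and simple orderings\<close>

lemma group_sum_mod:
  assumes "v > 0"
  shows "group_sum (integer_mod_group v) (map (\<lambda>x. x mod int v) xs) = sum_list xs mod int v"
  using assms by (induction xs) (auto simp: group_sum_def mod_simps)

lemma sum_list_rotate1: "sum_list (rotate1 xs) = sum_list (xs :: int list)"
  by (cases xs) auto

lemma sum_list_rotate: "sum_list (rotate r xs) = sum_list (xs :: int list)"
  by (induction r) (auto simp: sum_list_rotate1)

definition simple_mod :: "int \<Rightarrow> int list \<Rightarrow> bool" where
  "simple_mod v xs \<longleftrightarrow> inj_on (\<lambda>i. sum_list (take i xs) mod v) {1..length xs}"

lemma simple_ordering_mod:
  assumes "v > 0"
  shows "simple_ordering (integer_mod_group v) (map (\<lambda>x. x mod int v) xs) \<longleftrightarrow> simple_mod (int v) xs"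
  using assms by (simp add: simple_ordering_def simple_mod_def take_map group_sum_mod)

text \<open>When the total is zero, rotating the list translates the cyclic sequence of partial sums.\<close>

lemma simple_mod_rotate1:
  assumes "simple_mod v xs" "sum_list xs = 0"
  shows "simple_mod v (rotate1 xs)"
proof (cases xs)
  case (Cons x ys)
  define s where "s i = sum_list (take i xs)" for i
  \<comment> \<open>The last partial sum of the rotated list is the total 0, which equals
    \<open>s 1 - x\<close>; hence the wrap to 1.\<close>
  define \<pi> where "\<pi> i = (if i = length xs then 1 else Suc i)" for i
  have s: "sum_list (take i (rotate1 xs)) = s (\<pi> i) - x" if "i \<in> {1..length xs}" for i
    using that assms(2) Cons by (auto simp: s_def \<pi>_def)
  have "inj_on \<pi> {1..length xs}" and "\<pi> ` {1..length xs} \<subseteq> {1..length xs}"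
    using Cons by (auto simp: \<pi>_def inj_on_def split: if_splits)
  moreover have "inj_on (\<lambda>i. (s i - x) mod v) {1..length xs}"
    using assms(1) unfolding simple_mod_def s_def inj_on_def
    by (metis diff_add_cancel mod_add_left_eq)
  ultimately have "inj_on ((\<lambda>i. (s i - x) mod v) \<circ> \<pi>) {1..length xs}"
    by (blast intro: comp_inj_on inj_on_subset)
  then show ?thesis
    unfolding simple_mod_def length_rotate1 by (rule inj_on_cong[THEN iffD1, rotated]) (simp add: s)
qed (use assms in simp)

lemma simple_mod_rotate:
  assumes "simple_mod v xs" "sum_list xs = 0"
  shows "simple_mod v (rotate r xs)"
proof (induction r)
  case (Suc r)
  then show ?case
    using simple_mod_rotate1[of v "rotate r xs"] assms(2) by (simp add: sum_list_rotate)
qed (use assms in simp)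

lemma signed_rep_mod:
  assumes "odd v" "\<bar>x\<bar> \<le> int (v div 2)"
  shows "signed_rep v (x mod int v) = x"
proof -
  have v: "int v = 2 * int (v div 2) + 1"
    using assms(1) by (metis int_ops(2) of_nat_add of_nat_mult of_nat_numeral odd_two_times_div_two_succ)
  show ?thesis
  proof (cases "x \<ge> 0")
    case True
    then have "x mod int v = x" using assms(2) v by (intro mod_pos_pos_trivial) auto
    then show ?thesis using True assms(2) by (simp add: signed_rep_def)
  next
    case False
    have "(x + int v) mod int v = x + int v"
      using False assms(2) v by (intro mod_pos_pos_trivial) auto
    then have "x mod int v = x + int v" by simp
    then show ?thesis using False assms(2) v by (simp add: signed_rep_def)
  qed
qed

text \<open>With \<open>d = 2 * n + 1\<close> and \<open>e = 9\<close> this provides the subgroup of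
  order 9 that the array avoids.\<close>

lemma subgroup_multiples:
  assumes "d > 0" "e > 0"
  defines "J \<equiv> {x \<in> {0..<int (d * e)}. int d dvd x}"
  shows "subgroup J (integer_mod_group (d * e))" "card J = e"
proof -
  have de: "int d dvd x mod int (d * e) \<longleftrightarrow> int d dvd x" for x
    by (simp add: dvd_mod_iff)
  show "subgroup J (integer_mod_group (d * e))"
  proof (rule group.subgroupI)
    show "J \<subseteq> carrier (integer_mod_group (d * e))"
      using assms(1,2) by (auto simp: J_def carrier_integer_mod_group)
    then show "inv\<^bsub>integer_mod_group (d * e)\<^esub> a \<in> J" if "a \<in> J" for a
      using that assms(1,2) by (subst inv_integer_mod_group) (auto simp: J_def de simp del: of_nat_mult)
    show "J \<noteq> {}"
      using assms(1,2) by (auto simp: J_def intro!: exI[of _ 0])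
    show "a \<otimes>\<^bsub>integer_mod_group (d * e)\<^esub> b \<in> J" if "a \<in> J" "b \<in> J" for a b
      using that assms(1,2) by (auto simp: J_def de simp del: of_nat_mult)
  qed simp
  have "J = (\<lambda>k. int d * int k) ` {..<e}"
  proof
    show "J \<subseteq> (\<lambda>k. int d * int k) ` {..<e}"
    proof
      fix x assume "x \<in> J"
      then obtain k where k: "x = int d * k" "0 \<le> x" "x < int d * int e"
        by (auto simp: J_def)
      then have "0 \<le> k" "k < int e" using assms(1)
        by (auto simp: zero_le_mult_iff)
      then show "x \<in> (\<lambda>k. int d * int k) ` {..<e}"
        using k(1) by (intro image_eqI[of _ _ "nat k"]) auto
    qed
  qed (use assms(1) in \<open>auto simp: J_def\<close>)
  moreover have "inj_on (\<lambda>k. int d * int k) {..<e}"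
    using assms(1) by (auto simp: inj_on_def)
  ultimately show "card J = e" by (simp add: card_image)
qed

lemma mod_int_cases:
  fixes e N :: int
  assumes "- N \<le> e" "e < 2 * N"
  shows "e mod N = (if e < 0 then e + N else if e < N then e else e - N)"
proof -
  have "(e + N) mod N = e + N" if "e < 0"
    using that assms by (intro mod_pos_pos_trivial) auto
  moreover have "(e - N) mod N = e - N" if "e \<ge> N"
    using that assms by (intro mod_pos_pos_trivial) auto
  ultimately show ?thesis
    by auto
qed

text \<open>Congruence would make the difference a multiple of \<open>v\<close>, and only 0,
  \<open>v\<close> and \<open>- v\<close> are small enough. This trades congruences for linear
  conditions.\<close>

lemma mod_neq_if_small:
  fixes a b v :: int
    assumes "\<bar>a - b\<bar> < 2 * v" "a \<noteq> b" "a - b \<noteq> v" "b - a \<noteq> v"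
  shows "a mod v \<noteq> b mod v"
proof
  assume "a mod v = b mod v"
  then obtain k where k: "a - b = v * k"
    by (metis mod_eq_dvd_iff dvdE)
  have "v > 0" using assms(1) by auto
  have "\<bar>k\<bar> < 2"
    using assms(1) \<open>v > 0\<close> unfolding k by (simp add: abs_mult)
  then have "k = 0 \<or> k = 1 \<or> k = -1" by auto
  then show False using k assms by auto
qed

lemma simple_mod_iff_distinct:
  "simple_mod v xs \<longleftrightarrow> distinct (map (\<lambda>i. sum_list (take i xs) mod v) [1..<Suc (length xs)])"
  unfolding simple_mod_def distinct_map set_upt by (simp add: atLeastLessThanSuc_atLeastAtMost)

text \<open>\<open>sorted_wrt\<close> lists each pair of partial sums once, so an explicit list
  leaves only linear goals over the integers.\<close>

lemma simple_modI:
  assumes "sorted_wrt (\<lambda>a b. a - b < 2 * v \<and> b - a < 2 * v \<and> a \<noteq> b \<and> a - b \<noteq> v \<and> b - a \<noteq> v)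
    (map (\<lambda>i. sum_list (take i xs)) [1..<Suc (length xs)])"
  shows "simple_mod v xs"
proof -
  have "sorted_wrt (\<lambda>a b. a mod v \<noteq> b mod v) (map (\<lambda>i. sum_list (take i xs)) [1..<Suc (length xs)])"
    using assms by (rule sorted_wrt_mono_rel[rotated]) (elim conjE, intro mod_neq_if_small; linarith)
  then show ?thesis
    by (simp add: simple_mod_iff_distinct distinct_conv_nth sorted_wrt_iff_nth_less del: upt_Suc)
       (metis nat_neq_iff)
qed

text \<open>Apart from \<open>c\<close> itself, every sum of at most four cyclically consecutive entries lies in an interval
  that avoids the multiples of the modulus; longer sums are complements of these, as the total is zero.\<close>

lemma simple_mod_row:
  fixes N c l1 l2 l3 l4 l5 l6 l7 l8 :: int
  assumes c: "c \<noteq> 0"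
    and b: "N \<ge> 11" "- N \<le> c" "c \<le> N"
    "0 \<le> l1" "l1 \<le> N - 1" "0 \<le> l2" "l2 \<le> N - 1" "0 \<le> l3" "l3 \<le> N - 1"
    "0 \<le> l4" "l4 \<le> N - 1" "0 \<le> l5" "l5 \<le> N - 1" "0 \<le> l6" "l6 \<le> N - 1"
    "0 \<le> l7" "l7 \<le> N - 1" "0 \<le> l8" "l8 \<le> N - 1"
    "c = 4 * N - 4 - (l1 + l2 + l3 + l4 + l5 + l6 + l7 + l8)"
  shows "simple_mod (18 * N + 9) [c, 8 * N + 5 + l1, - (3 * N + 1) + l2, 3 * N + 2 + l3, - (6 * N + 2) + l4,
    - (8 * N + 3) + l5, 6 * N + 4 + l6, - (5 * N + 2) + l7, N + 1 + l8]"
proof (rule simple_modI, simp, intro conjI)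
\<comment> \<open>Only the first and last partial sums, \<open>c\<close> and 0, need
  \<open>c\<close> nonzero to be told apart. The last assumption in \<open>b\<close> says that the
  total is zero.\<close>
qed (use b in linarith | use b c in linarith)+

lemma simple_mod_column:
  fixes N c l1 l2 l3 l4 l5 l6 l7 l8 :: int
  assumes c: "c \<noteq> 0"
    and b: "N \<ge> 11" "- N \<le> c" "c \<le> N"
    "0 \<le> l1" "l1 \<le> N - 1" "0 \<le> l2" "l2 \<le> N - 1" "0 \<le> l3" "l3 \<le> N - 1"
    "0 \<le> l4" "l4 \<le> N - 1" "0 \<le> l5" "l5 \<le> N - 1" "0 \<le> l6" "l6 \<le> N - 1"
    "0 \<le> l7" "l7 \<le> N - 1" "0 \<le> l8" "l8 \<le> N - 1"
    "c = 4 * N - 4 - (l1 + l2 + l3 + l4 + l5 + l6 + l7 + l8)"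
  shows "simple_mod (18 * N + 9) [c, N + 1 + l1, - (5 * N + 2) + l2, 6 * N + 4 + l3, - (8 * N + 3) + l4,
    - (6 * N + 2) + l5, 3 * N + 2 + l6, - (3 * N + 1) + l7, 8 * N + 5 + l8]"
proof (rule simple_modI, simp, intro conjI)
qed (use b in linarith | use b c in linarith)+

section \<open>The array\<close>

text \<open>Here \<open>n = 2 * h + 1\<close>, so the offset -h becomes \<open>h + 1\<close>. For
  \<open>m = 1\<close> the offsets 3 and \<open>h\<close> would coincide.\<close>

locale circulant_heffter =
  fixes n m h :: nat
  assumes n_eq: "n = 4 * m + 3" and h_eq: "h = 2 * m + 1" and m_ge: "m \<ge> 2"
begin

definition offsets :: "nat list" where
  "offsets = [0, 1, 2, 3, h, h + 1, n - 3, n - 2, n - 1]"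

definition label1 :: "int \<Rightarrow> int" where "label1 i = i mod int n"
definition label2 :: "int \<Rightarrow> int" where "label2 i = (- i) mod int n"
definition label3 :: "int \<Rightarrow> int" where "label3 i = (i + int m) mod int n"

text \<open>These labels, and the four pairs of offsets, were found by a computer search: they are chosen so
  that the entries of the main diagonal are, up to sign, the numbers \<open>1, \<dots>, n\<close>.\<close>

definition centre :: "int \<Rightarrow> int" where
  "centre i = 4 * (int n - 1) - (label1 i + label1 (i - 1)) - (label2 i + label2 (i - 2))
     - (label1 i + label1 (i - 3)) - (label3 i + label3 (i - int h))"

text \<open>The entries of row (column) \<open>i\<close> for \<open>p = P\<close>, \<open>q = Q\<close> (for \<open>p = Q\<close>, \<open>q = P\<close>) in cyclic order,
  starting from the main diagonal and listed by \<^const>\<open>offsets\<close>.\<close>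

definition line :: "int list \<Rightarrow> int list \<Rightarrow> int \<Rightarrow> int list" where
  "line p q i = [centre i, p ! 0 + label1 i, p ! 1 + label2 i, p ! 2 + label1 i, p ! 3 + label3 i,
     q ! 3 + label3 (i - int h), q ! 2 + label1 (i - 3), q ! 1 + label2 (i - 2), q ! 0 + label1 (i - 1)]"

text \<open>The \<open>2 * n\<close> numbers between two consecutive multiples of \<open>2 * n + 1\<close> form two blocks of length
  \<open>n\<close>; each shift in \<open>P\<close> or \<open>Q\<close> moves the range of the labels to one of these blocks or its negative.\<close>

definition P :: "int list" where
  "P = [8 * int n + 5, - (3 * int n + 1), 3 * int n + 2, - (6 * int n + 2)]"

definition Q :: "int list" where
  "Q = [int n + 1, - (5 * int n + 2), 6 * int n + 4, - (8 * int n + 3)]"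

section \<open>Periodicity, bounds and the values on the main diagonal\<close>

lemma periodic:
  "label1 (i + int n) = label1 i" "label2 (i + int n) = label2 i" "label3 (i + int n) = label3 i"
  "label1 (i mod int n) = label1 i" "label2 (i mod int n) = label2 i" "label3 (i mod int n) = label3 i"
  by (simp_all add: label1_def label2_def label3_def mod_simps algebra_simps)
     (simp_all add: mod_simps flip: add.assoc)

lemma periodic_diff:
  "label1 (i mod int n - k) = label1 (i - k)" "label2 (i mod int n - k) = label2 (i - k)"
  "label3 (i mod int n - k) = label3 (i - k)"
  by (metis mod_diff_left_eq periodic(4-6))+

lemma centre_mod: "centre (i mod int n) = centre i"
  by (simp add: centre_def periodic periodic_diff)

lemma line_mod: "line p q (i mod int n) = line p q i"
  by (simp add: line_def periodic periodic_diff centre_mod)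

lemma label_bounds:
  "0 \<le> label1 i" "label1 i \<le> int n - 1" "0 \<le> label2 i" "label2 i \<le> int n - 1"
  "0 \<le> label3 i" "label3 i \<le> int n - 1"
proof -
  have "int n > 0" using n_eq by simp
  then show "0 \<le> label1 i" "label1 i \<le> int n - 1" "0 \<le> label2 i" "label2 i \<le> int n - 1"
    "0 \<le> label3 i" "label3 i \<le> int n - 1"
    by (simp_all add: label1_def label2_def label3_def zle_diff1_eq)
qed

text \<open>The wraps of \<open>label1 (i - 1)\<close> and \<open>label2 i\<close> together
  contribute exactly one \<open>n\<close>, as do those of \<open>label1 (i - 3)\<close> and
  \<open>label2 (i - 2)\<close>. Only the wraps of the two \<open>label3\<close> terms remain
  visible, at \<open>m + 1\<close> and \<open>3 * m + 3\<close>.\<close>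

lemma centre_eq:
  assumes "0 \<le> i" "i < int n"
  shows "centre i = 4 * int m + 2 - 4 * i + (if i > int m then int n else 0)
    + (if i \<ge> 3 * int m + 3 then int n else 0)"
proof -
  have N: "int n = 4 * int m + 3" "int h = 2 * int m + 1" "int m \<ge> 2"
    using n_eq h_eq m_ge by auto
  have l: "label1 i = i" "label1 (i - 1) = (if i < 1 then i - 1 + int n else i - 1)"
    "label1 (i - 3) = (if i < 3 then i - 3 + int n else i - 3)"
    "label2 i = (if i > 0 then int n - i else 0)"
    "label2 (i - 2) = (if i > 2 then int n - i + 2 else 2 - i)"
    "label3 i = (if i + int m < int n then i + int m else i + int m - int n)"
    "label3 (i - int h) = (if i + int m - int h < 0 then i + int m - int h + int n else i + int m - int h)"
    unfolding label1_def label2_def label3_def using assms N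
    by (subst mod_int_cases; auto)+
  show ?thesis
    unfolding centre_def l using assms N by (auto split: if_splits)
qed

lemma centre_bounds: "- int n \<le> centre i" "centre i \<le> int n" "centre i \<noteq> 0"
proof -
  define j where "j = i mod int n"
  have j: "0 \<le> j" "j < int n" using n_eq by (auto simp: j_def)
  have eq: "centre i = centre j" by (simp add: j_def centre_mod)
  show "- int n \<le> centre i" "centre i \<le> int n"
    unfolding eq centre_eq[OF j] using j n_eq by (auto split: if_splits)
  \<comment> \<open>With no or one added \<open>n\<close> the value is 2 modulo 4 or odd; with two
    it is \<open>4 * (3 * m + 2 - j)\<close>, where \<open>j \<ge> 3 * m + 3\<close>.\<close>
  show "centre i \<noteq> 0"
    unfolding eq centre_eq[OF j] using n_eq j by (auto split: if_splits; presburger)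
qed

text \<open>The eight shifts in \<open>P\<close> and \<open>Q\<close> add up to
  \<open>4 - 4 * int n\<close>, which the constant in \<open>centre\<close> cancels.\<close>

lemma sum_line: "sum_list (line P Q i) = 0" "sum_list (line Q P i) = 0"
  by (simp_all add: line_def P_def Q_def centre_def)

text \<open>The bound is half the modulus rounded down, so the integers in \<open>line\<close> are
  already the signed representatives of their residues.\<close>

lemma line_bound:
  "x \<in> set (line P Q i) \<Longrightarrow> \<bar>x\<bar> \<le> 9 * int n + 4"
  "x \<in> set (line Q P i) \<Longrightarrow> \<bar>x\<bar> \<le> 9 * int n + 4"
  using label_bounds[of i] label_bounds[of "i - 1"] label_bounds[of "i - 2"] label_bounds[of "i - 3"]
    label_bounds[of "i - int h"] centre_bounds[of i]
  by (auto simp: line_def P_def Q_def)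

lemma simple_mod_line:
  "simple_mod (18 * int n + 9) (line P Q i)" "simple_mod (18 * int n + 9) (line Q P i)"
proof -
  have n11: "int n \<ge> 11" using n_eq m_ge by auto
  have total: "centre i = 4 * int n - 4 - (label1 i + label2 i + label1 i + label3 i
      + label3 (i - int h) + label1 (i - 3) + label2 (i - 2) + label1 (i - 1))"
    by (simp add: centre_def)
  have row: "line P Q i = [centre i, 8 * int n + 5 + label1 i, - (3 * int n + 1) + label2 i,
      3 * int n + 2 + label1 i, - (6 * int n + 2) + label3 i, - (8 * int n + 3) + label3 (i - int h),
      6 * int n + 4 + label1 (i - 3), - (5 * int n + 2) + label2 (i - 2), int n + 1 + label1 (i - 1)]"
    by (simp add: line_def P_def Q_def)
  show "simple_mod (18 * int n + 9) (line P Q i)"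
    unfolding row by (rule simple_mod_row; fact centre_bounds n11 label_bounds total)
  have column: "line Q P i = [centre i, int n + 1 + label1 i, - (5 * int n + 2) + label2 i,
      6 * int n + 4 + label1 i, - (8 * int n + 3) + label3 i, - (6 * int n + 2) + label3 (i - int h),
      3 * int n + 2 + label1 (i - 3), - (3 * int n + 1) + label2 (i - 2), 8 * int n + 5 + label1 (i - 1)]"
    by (simp add: line_def P_def Q_def)
  show "simple_mod (18 * int n + 9) (line Q P i)"
    unfolding column by (rule simple_mod_column; fact centre_bounds n11 label_bounds total)
qed

lemma size_bounds: "3 < h" "Suc h < n - 3" "Suc h < n - 2" "Suc h < n - 1" "n - 3 < n" "3 < n - 3"
  "n - 3 < n - 2" "n - 3 < n - 1" "n - 2 < n - 1" "3 \<le> n" "h < n - 3" "Suc h < n"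
  using n_eq h_eq m_ge by auto

lemma length_line: "length (line p q i) = length offsets"
  by (simp add: line_def offsets_def)

lemma offsets_list:
  "sorted offsets" "distinct offsets" "set offsets \<subseteq> {..<n}" "length offsets = 9"
  using size_bounds by (auto simp: offsets_def)

section \<open>Rows and columns of the array\<close>

definition modulus :: nat where "modulus = 18 * n + 9"

definition array :: "int pf_array" where
  "array a b = map_option (\<lambda>x. x mod int modulus)
     (map_of (zip offsets (line P Q (int a))) ((n + b - a) mod n))"

lemma map_of_map_snd: "map_of (zip ds (map f L)) d = map_option f (map_of (zip ds L) d)"
  by (simp add: zip_map2 map_of_map)

lemma map_of_line:
  "map_of (zip offsets (line p q i)) 0 = Some (centre i)"
  "map_of (zip offsets (line p q i)) 1 = Some (p ! 0 + label1 i)"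
  "map_of (zip offsets (line p q i)) 2 = Some (p ! 1 + label2 i)"
  "map_of (zip offsets (line p q i)) 3 = Some (p ! 2 + label1 i)"
  "map_of (zip offsets (line p q i)) h = Some (p ! 3 + label3 i)"
  "map_of (zip offsets (line p q i)) (h + 1) = Some (q ! 3 + label3 (i - int h))"
  "map_of (zip offsets (line p q i)) (n - 3) = Some (q ! 2 + label1 (i - 3))"
  "map_of (zip offsets (line p q i)) (n - 2) = Some (q ! 1 + label2 (i - 2))"
  "map_of (zip offsets (line p q i)) (n - 1) = Some (q ! 0 + label1 (i - 1))"
  using size_bounds by (auto simp: offsets_def line_def)

text \<open>Needed because transposition negates offsets; the outer \<open>mod n\<close> matters
  only for \<open>d = 0\<close>.\<close>

lemma offsets_mirror: "d < n \<Longrightarrow> (n - d) mod n \<in> set offsets \<longleftrightarrow> d \<in> set offsets"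
proof (cases "d = 0")
  case False
  assume "d < n"
  then have "(n - d) mod n = n - d" using False by simp
  moreover have "n = 2 * h + 1" using n_eq h_eq by simp
  then have "n - d = 1 \<longleftrightarrow> d = n - 1" "n - d = 2 \<longleftrightarrow> d = n - 2" "n - d = 3 \<longleftrightarrow> d = n - 3"
    "n - d = h \<longleftrightarrow> d = h + 1" "n - d = h + 1 \<longleftrightarrow> d = h" "n - d = n - 3 \<longleftrightarrow> d = 3"
    "n - d = n - 2 \<longleftrightarrow> d = 2" "n - d = n - 1 \<longleftrightarrow> d = 1" "n - d \<noteq> 0"
    using \<open>d < n\<close> size_bounds by linarith+
  ultimately show ?thesis
    using False unfolding offsets_def by auto
qed (simp add: offsets_def)

text \<open>The cell of row \<open>i\<close> at offset \<open>d\<close> lies in column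
  \<open>i + d\<close>, seen from which its offset is \<open>- d\<close>. The second half of
  \<open>line\<close> mirrors the first with \<open>p\<close> and \<open>q\<close> exchanged and the
  labels shifted back by \<open>d\<close>, so a column reads like a row with \<open>P\<close> and
  \<open>Q\<close> exchanged.\<close>

lemma entry_transpose:
  assumes "d < n"
  shows "map_of (zip offsets (line p q i)) d =
    map_of (zip offsets (line q p (i + int d))) ((n - d) mod n)"
proof (cases "d \<in> set offsets")
  case False
  then have "map_of (zip offsets (line p q i)) d = None"
    "map_of (zip offsets (line q p (i + int d))) ((n - d) mod n) = None"
    using offsets_mirror[OF assms] by (simp_all add: map_of_zip_is_None length_line)
  then show ?thesis by simp
next
  case True
  have n: "n = 2 * h + 1"
    using n_eq h_eq by simp
  have mirror: "(n - 0) mod n = 0" "(n - 1) mod n = n - 1" "(n - 2) mod n = n - 2" "(n - 3) mod n = n - 3"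
    "(n - h) mod n = h + 1" "(n - (h + 1)) mod n = h"
    "(n - (n - 3)) mod n = 3" "(n - (n - 2)) mod n = 2" "(n - (n - 1)) mod n = 1"
    using size_bounds n by (simp_all add: mod_if)
  have int_diff: "int (n - 1) = int n - 1" "int (n - 2) = int n - 2" "int (n - 3) = int n - 3"
    using size_bounds by (simp_all add: of_nat_diff)
  have wrap: "label1 (i + (int n - k)) = label1 (i - k)" "label2 (i + (int n - k)) = label2 (i - k)"
    "label3 (i + (int n - k)) = label3 (i - k)" for k
    using periodic(1-3)[of "i - k"] by (simp_all add: algebra_simps)
  have wrap_h: "label3 (i + int (h + 1)) = label3 (i - int h)"
    using wrap(3)[of "int h"] n by (simp add: algebra_simps)
  note simps = map_of_line mirror int_diff wrap wrap_h add_diff_cancel_right' of_nat_0 of_nat_1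
    of_nat_numeral add_0_right
  consider "d = 0" | "d = 1" | "d = 2" | "d = 3" | "d = h" | "d = h + 1"
    | "d = n - 3" | "d = n - 2" | "d = n - 1"
    using True by (auto simp: offsets_def)
  then show ?thesis
    by cases (simp_all only: simps)
qed

lemma array_transpose:
  assumes "a \<in> {1..n}" "b \<in> {1..n}"
  shows "array a b = map_option (\<lambda>x. x mod int modulus)
     (map_of (zip offsets (line Q P (int b))) ((n + a - b) mod n))"
proof -
  define d where "d = (n + b - a) mod n"
  have "d = (if a \<le> b then b - a else n + b - a)"
    using assms by (auto simp: d_def mod_if)
  then have "(n - d) mod n = (n + a - b) mod n" and "d < n"
    and "(int a + int d) mod int n = int b mod int n"
    using assms by (auto simp: mod_if of_nat_diff algebra_simps)
  then show ?thesis
    unfolding array_def d_def[symmetric] entry_transpose[OF \<open>d < n\<close>] by (metis line_mod)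
qed

lemma row_list_array:
  assumes "a \<in> {1..n}"
  obtains r where "row_list n array a = map (\<lambda>x. x mod int modulus) (rotate r (line P Q (int a)))"
  using map_filter_circulant[OF offsets_list(1-3), of "map (\<lambda>x. x mod int modulus) (line P Q (int a))" a] assms
  by (auto simp: row_list_def array_def map_of_map_snd length_line rotate_map simp del: upt_Suc)

lemma col_list_array:
  assumes "b \<in> {1..n}"
  obtains r where "col_list n array b = map (\<lambda>x. x mod int modulus) (rotate r (line Q P (int b)))"
proof -
  have "col_list n array b = List.map_filter (\<lambda>a. map_of (zip offsets (map (\<lambda>x. x mod int modulus) (line Q P (int b))))
      ((n + a - b) mod n)) [1..<Suc n]"
    unfolding col_list_def map_of_map_snd
    by (rule map_filter_cong) (use assms in \<open>simp add: array_transpose del: upt_Suc\<close>)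
  then show ?thesis
    using map_filter_circulant[OF offsets_list(1-3), of "map (\<lambda>x. x mod int modulus) (line Q P (int b))" b]
      assms that by (auto simp: length_line rotate_map simp del: upt_Suc)
qed

lemma filled_iff: "array a b \<noteq> None \<longleftrightarrow> (n + b - a) mod n \<in> set offsets"
  unfolding array_def by (simp add: map_of_zip_is_None length_line)

section \<open>Covering the residues outside the subgroup\<close>

lemma entries_array:
  assumes "x \<in> set (line P Q i)"
  shows "x mod int modulus \<in> entries n array"
proof -
  have n: "n > 0" using n_eq by simp
  then obtain k :: nat where k: "i mod int n = int k" "k < n"
    by (metis of_nat_0_less_iff of_nat_less_iff pos_mod_bound pos_mod_sign zero_le_imp_eq_int)
  \<comment> \<open>Rows are numbered from 1, so residue 0 belongs to row \<open>n\<close>.\<close>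
  define a where "a = (if k = 0 then n else k)"
  have a: "a \<in> {1..n}" and "int a mod int n = i mod int n"
    using k n by (auto simp: a_def)
  then have "line P Q (int a) = line P Q i"
    by (metis line_mod)
  then obtain r where "row_list n array a = map (\<lambda>x. x mod int modulus) (rotate r (line P Q i))"
    using row_list_array[OF a] by metis
  then have "x mod int modulus \<in> set (row_list n array a)"
    using assms by simp
  then show ?thesis
    using a by (force simp: row_list_def entries_def List.map_filter_def)
qed

text \<open>In \<open>centre_eq\<close>, \<open>i \<le> m\<close> gives the positive values 2 modulo
  4, the middle range the values 1 modulo 4, positive up to \<open>i = 2 * m + 1\<close> and
  negative after it, and the last range the negative multiples of 4. Solving for \<open>i\<close>
  yields the witnesses.\<close>

lemma centre_cover:
  assumes "1 \<le> z" "z \<le> int n"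
  shows "\<exists>i. centre i = z \<or> centre i = - z"
proof -
  have N: "int n = 4 * int m + 3" using n_eq by simp
  define k where "k = z div 4"
  have "z = 4 * k \<or> z = 4 * k + 1 \<or> z = 4 * k + 2 \<or> z = 4 * k + 3"
    unfolding k_def by presburger
  then consider "z = 4 * k" | "z = 4 * k + 1" | "z = 4 * k + 2" | "z = 4 * k + 3"
    by blast
  then show ?thesis
  proof cases
    case 1
    then show ?thesis using assms N by (intro exI[of _ "3 * int m + 2 + k"]) (simp add: centre_eq)
  next
    case 2
    then show ?thesis using assms N by (intro exI[of _ "2 * int m + 1 - k"]) (simp add: centre_eq)
  next
    case 3
    then show ?thesis using assms N by (intro exI[of _ "int m - k"]) (simp add: centre_eq)
  next
    case 4
    then show ?thesis using assms N by (intro exI[of _ "2 * int m + 2 + k"]) (simp add: centre_eq)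
  qed
qed

text \<open>Without the four multiples of \<open>2 * n + 1\<close> there remain nine blocks of
  length \<open>n\<close>. The main diagonal covers the first, and each outer diagonal covers one of
  the others up to sign, since its label takes all values from 0 to \<open>n - 1\<close>.\<close>

lemma line_cover:
  assumes "1 \<le> z" "z \<le> 9 * int n + 4" "\<not> (2 * int n + 1) dvd z"
  shows "\<exists>i. z \<in> set (line P Q i) \<or> - z \<in> set (line P Q i)"
proof -
  have preimage: "label1 r = r" "label2 (- r) = r" "label3 (r - int m) = r" if "0 \<le> r" "r < int n" for r
    using that by (simp_all add: label1_def label2_def label3_def)
  have surj: "\<exists>i. label1 i = r" "\<exists>i. label2 i = r" "\<exists>i. label3 i = r" if "0 \<le> r" "r < int n" for r
    using preimage[OF that] by blast+
  have "label1 (r + k - k) = r" "label2 (- r + k - k) = r" "label3 (r - int m + k - k) = r"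
    if "0 \<le> r" "r < int n" for r k
    using preimage[OF that] by simp_all
  then have shift: "\<exists>i. label1 (i - k) = r" "\<exists>i. label2 (i - k) = r" "\<exists>i. label3 (i - k) = r"
    if "0 \<le> r" "r < int n" for r k
    using that by blast+
  have "z \<noteq> (2 * int n + 1) * c" for c using assms(3) by auto
  from this[of 1] this[of 2] this[of 3] this[of 4]
  have "z \<noteq> 2 * int n + 1" "z \<noteq> 4 * int n + 2" "z \<noteq> 6 * int n + 3" "z \<noteq> 8 * int n + 4"
    by simp_all
  then consider "z \<le> int n" | "int n + 1 \<le> z" "z \<le> 2 * int n" | "2 * int n + 2 \<le> z" "z \<le> 3 * int n + 1"
    | "3 * int n + 2 \<le> z" "z \<le> 4 * int n + 1" | "4 * int n + 3 \<le> z" "z \<le> 5 * int n + 2"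
    | "5 * int n + 3 \<le> z" "z \<le> 6 * int n + 2" | "6 * int n + 4 \<le> z" "z \<le> 7 * int n + 3"
    | "7 * int n + 4 \<le> z" "z \<le> 8 * int n + 3" | "8 * int n + 5 \<le> z" 
    by linarith
  then show ?thesis
  proof cases
    case 1
    then obtain i where "centre i = z \<or> centre i = - z" using centre_cover[OF assms(1)] by blast
    moreover have "centre i \<in> set (line P Q i)" by (simp add: line_def)
    ultimately show ?thesis by metis
  next
    case 2
    then obtain i where "label1 (i - 1) = z - (int n + 1)"
      using shift(1)[of "z - (int n + 1)" 1] by auto
    then have "z = Q ! 0 + label1 (i - 1)" by (simp add: Q_def)
    then show ?thesis by (auto simp: line_def)
  next
    case 3
    then obtain i where "label2 i = 3 * int n + 1 - z"
      using surj(2)[of "3 * int n + 1 - z"] by auto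
    then have "- z = P ! 1 + label2 i" by (simp add: P_def)
    then show ?thesis by (auto simp: line_def)
  next
    case 4
    then obtain i where "label1 i = z - (3 * int n + 2)"
      using surj(1)[of "z - (3 * int n + 2)"] by auto
    then have "z = P ! 2 + label1 i" by (simp add: P_def)
    then show ?thesis by (auto simp: line_def)
  next
    case 5
    then obtain i where "label2 (i - 2) = 5 * int n + 2 - z"
      using shift(2)[of "5 * int n + 2 - z" 2] by auto
    then have "- z = Q ! 1 + label2 (i - 2)" by (simp add: Q_def)
    then show ?thesis by (auto simp: line_def)
  next
    case 6
    then obtain i where "label3 i = 6 * int n + 2 - z"
      using surj(3)[of "6 * int n + 2 - z"] by auto
    then have "- z = P ! 3 + label3 i" by (simp add: P_def)
    then show ?thesis by (auto simp: line_def)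
  next
    case 7
    then obtain i where "label1 (i - 3) = z - (6 * int n + 4)"
      using shift(1)[of "z - (6 * int n + 4)" 3] by auto
    then have "z = Q ! 2 + label1 (i - 3)" by (simp add: Q_def)
    then show ?thesis by (auto simp: line_def)
  next
    case 8
    then obtain i where "label3 (i - int h) = 8 * int n + 3 - z"
      using shift(3)[of "8 * int n + 3 - z" "int h"] by auto
    then have "- z = Q ! 3 + label3 (i - int h)" by (simp add: Q_def)
    then show ?thesis by (auto simp: line_def)
  next
    case 9
    then obtain i where "label1 i = z - (8 * int n + 5)"
      using surj(1)[of "z - (8 * int n + 5)"] assms(2) by auto
    then have "z = P ! 0 + label1 i" by (simp add: P_def)
    then show ?thesis by (auto simp: line_def)
  qed
qed

section \<open>The Heffter conditions\<close>

lemma heffter_modulus: "heffter_modulus 9 n 9 = modulus"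
  by (simp add: heffter_modulus_def modulus_def)

lemma globally_simple_array: "globally_simple (heffter_group 9 n 9) n array"
  unfolding globally_simple_def heffter_modulus
proof (intro ballI conjI)
  fix i assume i: "i \<in> {1..n}"
  have v: "modulus > 0" "int modulus = 18 * int n + 9" by (simp_all add: modulus_def)
  obtain r where r: "row_list n array i = map (\<lambda>x. x mod int modulus) (rotate r (line P Q (int i)))"
    using row_list_array[OF i] .
  show "simple_ordering (integer_mod_group modulus) (row_list n array i)"
    unfolding r simple_ordering_mod[OF v(1)] unfolding v(2)
    by (intro simple_mod_rotate simple_mod_line sum_line)
  obtain c where c: "col_list n array i = map (\<lambda>x. x mod int modulus) (rotate c (line Q P (int i)))"
    using col_list_array[OF i] .
  show "simple_ordering (integer_mod_group modulus) (col_list n array i)"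
    unfolding c simple_ordering_mod[OF v(1)] unfolding v(2)
    by (intro simple_mod_rotate simple_mod_line sum_line)
qed

lemma relative_heffter_array: "relative_heffter 9 n 9 array"
  unfolding relative_heffter_def heffter_modulus
proof (intro conjI ballI)
  have v: "modulus > 0" "int modulus = 18 * int n + 9" "modulus = (2 * n + 1) * 9"
    by (simp_all add: modulus_def)
  show "3 \<le> (9::nat)" "9 \<le> n" "9 dvd 2 * n * 9"
    using n_eq m_ge by auto
  show "entries n array \<subseteq> carrier (integer_mod_group modulus)"
    using v(1) by (auto simp: entries_def array_def carrier_integer_mod_group)
  let ?J = "{x \<in> {0..<int modulus}. int (2 * n + 1) dvd x}"
  show "\<exists>J. subgroup J (integer_mod_group modulus) \<and> card J = 9 \<and>
      (\<forall>x\<in>carrier (integer_mod_group modulus) - J.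
        x \<in> entries n array \<or> inv\<^bsub>integer_mod_group modulus\<^esub> x \<in> entries n array)"
  proof (intro exI[of _ ?J] conjI ballI)
    show "subgroup ?J (integer_mod_group modulus)" "card ?J = 9"
      unfolding v(3) using subgroup_multiples[of "2 * n + 1" 9] by auto
    fix y assume y: "y \<in> carrier (integer_mod_group modulus) - ?J"
    then have "y \<in> {0..<int modulus}"
      using v(1) by (simp add: carrier_integer_mod_group)
    moreover from this have "\<not> int (2 * n + 1) dvd y"
      using y by blast
    moreover have "int (2 * n + 1) = 2 * int n + 1"
      by simp
    ultimately have y': "0 \<le> y" "y < 18 * int n + 9" "\<not> (2 * int n + 1) dvd y"
      unfolding v(2) by (simp_all only: atLeastLessThan_iff not_False_eq_True)
    then have "y \<noteq> 0" by auto
    have y_mod: "y mod int modulus = y" and inv: "inv\<^bsub>integer_mod_group modulus\<^esub> y = (- y) mod int modulus"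
      using y y' v by auto
    show "y \<in> entries n array \<or> inv\<^bsub>integer_mod_group modulus\<^esub> y \<in> entries n array"
    proof (cases "y \<le> 9 * int n + 4")
      case True
      then obtain i where "y \<in> set (line P Q i) \<or> - y \<in> set (line P Q i)"
        using line_cover[of y] y' \<open>y \<noteq> 0\<close> by auto
      then show ?thesis
        using entries_array y_mod inv by metis
    next
      case False
      \<comment> \<open>The negative of \<open>y\<close>, represented by
        \<open>int modulus - y\<close>, is below half the modulus, and it is still no multiple of
        \<open>2 * n + 1\<close>, which divides the modulus.\<close>
      have "\<not> (2 * int n + 1) dvd (2 * int n + 1) * 9 - y"
        using y'(3) by (metis dvd_diff_commute dvd_triv_left dvd_diff_right_iff)
      moreover have "int modulus - y = (2 * int n + 1) * 9 - y" using v(2) by simp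
      ultimately obtain i where "int modulus - y \<in> set (line P Q i) \<or> - (int modulus - y) \<in> set (line P Q i)"
        using line_cover[of "int modulus - y"] False y' v(2) by auto
      then have "(int modulus - y) mod int modulus \<in> entries n array
          \<or> (- (int modulus - y)) mod int modulus \<in> entries n array"
        using entries_array by blast
      then show ?thesis
        unfolding inv using y_mod by (auto simp: mod_simps)
    qed
  qed
  fix i assume i: "i \<in> {1..n}"
  obtain r where r: "row_list n array i = map (\<lambda>x. x mod int modulus) (rotate r (line P Q (int i)))"
    using row_list_array[OF i] .
  obtain c where c: "col_list n array i = map (\<lambda>x. x mod int modulus) (rotate c (line Q P (int i)))"
    using col_list_array[OF i] .
  show "length (row_list n array i) = 9" "length (col_list n array i) = 9"
    by (simp_all add: r c length_line offsets_list)
  show "group_sum (integer_mod_group modulus) (row_list n array i) = \<one>\<^bsub>integer_mod_group modulus\<^esub>"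
    "group_sum (integer_mod_group modulus) (col_list n array i) = \<one>\<^bsub>integer_mod_group modulus\<^esub>"
    unfolding r c group_sum_mod[OF v(1)] by (simp_all add: sum_list_rotate sum_line)
qed

lemma integer_relative_heffter_array: "integer_relative_heffter 9 n 9 array"
  unfolding integer_relative_heffter_def heffter_modulus
proof (intro conjI ballI relative_heffter_array)
  have "odd modulus" "int (modulus div 2) = 9 * int n + 4"
    by (simp_all add: modulus_def)
  then have rep: "map (signed_rep modulus) (map (\<lambda>x. x mod int modulus) xs) = xs"
    if "\<And>x. x \<in> set xs \<Longrightarrow> \<bar>x\<bar> \<le> 9 * int n + 4" for xs
    using that by (simp add: signed_rep_mod map_idI)
  fix i assume i: "i \<in> {1..n}"
  obtain r where "row_list n array i = map (\<lambda>x. x mod int modulus) (rotate r (line P Q (int i)))"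
    using row_list_array[OF i] .
  then show "sum_list (map (signed_rep modulus) (row_list n array i)) = 0"
    using rep[of "rotate r (line P Q (int i))"] line_bound(1)[of _ "int i"]
    by (simp add: sum_list_rotate sum_line)
  obtain c where "col_list n array i = map (\<lambda>x. x mod int modulus) (rotate c (line Q P (int i)))"
    using col_list_array[OF i] .
  then show "sum_list (map (signed_rep modulus) (col_list n array i)) = 0"
    using rep[of "rotate c (line Q P (int i))"] line_bound(2)[of _ "int i"]
    by (simp add: sum_list_rotate sum_line)
qed

section \<open>The filled diagonals\<close>

lemma set_offsets: "set offsets = {0, 1, 2, 3, h, h + 1, n - 3, n - 2, n - 1}"
  by (simp add: offsets_def)

text \<open>A diagonal is indexed by row minus column plus one, whereas an offset is column minus
  row; \<open>offsets_mirror\<close> absorbs the change of sign.\<close>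

lemma diagonal_offset:
  assumes "(a, b) \<in> diagonal n i" "i \<ge> 1"
  shows "array a b \<noteq> None \<longleftrightarrow> (i - 1) mod n \<in> set offsets"
proof -
  have ab: "a \<in> {1..n}" "b \<in> {1..n}" and "[a + 1 = i + b] (mod n)"
    using assms by (auto simp: diagonal_def)
  define d where "d = (n + b - a) mod n"
  have d: "d = (if a \<le> b then b - a else n + b - a)" "d < n"
    using ab by (auto simp: d_def mod_if)
  have "int n dvd (int a + 1) - (int i + int b)"
    using \<open>[a + 1 = i + b] (mod n)\<close> by (metis cong_iff_dvd_diff cong_int_iff of_nat_1 of_nat_add)
  moreover have "int n dvd int d - (int b - int a)"
    using d ab by (auto simp: of_nat_diff)
  ultimately have "int n dvd (int d - (int b - int a)) - ((int a + 1) - (int i + int b)) - int n"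
    by (meson dvd_diff dvd_refl)
  moreover have "(int d - (int b - int a)) - ((int a + 1) - (int i + int b)) - int n = int (i - 1) - int (n - d)"
    using assms(2) d(2) by (simp add: of_nat_diff)
  ultimately have "[i - 1 = n - d] (mod n)"
    by (simp only: cong_iff_dvd_diff flip: cong_int_iff)
  then show ?thesis
    using offsets_mirror[OF d(2)] unfolding filled_iff cong_def d_def[symmetric] by simp
qed

text \<open>Excludes a diagonal that is vacuously both filled and empty; the witness lies in column
  1.\<close>

lemma diagonal_nonempty: "\<exists>a b. (a, b) \<in> diagonal n i"
proof -
  define a where "a = (if i mod n = 0 then n else i mod n)"
  have "n > 0" using n_eq by simp
  then have "[a = i] (mod n)" and "a \<in> {1..n}"
    by (auto simp: a_def cong_def Suc_le_eq less_imp_le)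
  then have "(a, 1) \<in> diagonal n i"
    using \<open>n > 0\<close> by (auto simp: diagonal_def simp del: add_Suc_right intro: cong_add)
  then show ?thesis by blast
qed

lemma filled_diagonal_iff:
  assumes "i \<ge> 1"
  shows "filled_diagonal n array i \<longleftrightarrow> (i - 1) mod n \<in> set offsets"
proof -
  have "filled_diagonal n array i \<longleftrightarrow> (\<forall>a b. (a, b) \<in> diagonal n i \<longrightarrow> array a b \<noteq> None)"
    unfolding filled_diagonal_def filled_cells_def by (auto simp: diagonal_def)
  then show ?thesis
    using diagonal_offset[OF _ assms] diagonal_nonempty[of i] by blast
qed

lemma empty_diagonal_iff:
  assumes "i \<ge> 1"
  shows "empty_diagonal n array i \<longleftrightarrow> (i - 1) mod n \<notin> set offsets"
proof -
  have "empty_diagonal n array i \<longleftrightarrow> (\<forall>a b. (a, b) \<in> diagonal n i \<longrightarrow> array a b = None)"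
    unfolding empty_diagonal_def filled_cells_def disjoint_iff split_paired_All
    by (simp add: diagonal_def)
  then show ?thesis
    using diagonal_offset[OF _ assms] diagonal_nonempty[of i] by blast
qed

lemma k_diagonal_array: "k_diagonal n 9 array"
  unfolding k_diagonal_def
proof (intro conjI exI[of _ "Suc ` set offsets"])
  show "9 \<le> n" using n_eq m_ge by simp
  show "Suc ` set offsets \<subseteq> {1..n}" using offsets_list(3) by auto
  show "card (Suc ` set offsets) = 9"
    by (simp add: card_image distinct_card offsets_list)
  show "filled_cells n array = (\<Union>i\<in>Suc ` set offsets. diagonal n i)"
  proof (intro equalityI subsetI)
    fix x assume x: "x \<in> filled_cells n array"
    then obtain a b where ab: "x = (a, b)" "a \<in> {1..n}" "b \<in> {1..n}" "array a b \<noteq> None"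
      by (auto simp: filled_cells_def)
    define e where "e = (n + a - b) mod n"
    have e: "e = (if b \<le> a then a - b else n + a - b)" "e < n"
      using ab by (auto simp: e_def mod_if)
    then have "Suc e + b = a + 1 \<or> Suc e + b = n + (a + 1)"
      using ab(2,3) by auto
    then have "[a + 1 = Suc e + b] (mod n)"
      by (elim disjE) (simp_all only: cong_def mod_add_self1)
    then have "(a, b) \<in> diagonal n (Suc e)"
      using ab(2,3) by (simp add: diagonal_def)
    moreover from this have "e \<in> set offsets"
      using diagonal_offset[of a b "Suc e"] ab(4) e(2) by simp
    ultimately show "x \<in> (\<Union>i\<in>Suc ` set offsets. diagonal n i)"
      unfolding ab(1) by blast
  next
    fix x assume "x \<in> (\<Union>i\<in>Suc ` set offsets. diagonal n i)"
    then obtain e where "e \<in> set offsets" "x \<in> diagonal n (Suc e)"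
      by blast
    moreover obtain a b where "x = (a, b)"
      by (cases x)
    ultimately have "x = (a, b)" "(a, b) \<in> diagonal n (Suc e)" "e \<in> set offsets"
      by simp_all
    moreover from this have "array a b \<noteq> None"
      using diagonal_offset[of a b "Suc e"] offsets_list(3) by auto
    ultimately show "x \<in> filled_cells n array"
      by (auto simp: filled_cells_def diagonal_def)
  qed
qed

text \<open>Cyclically the filled residues form two runs, from \<open>n - 3\<close> through 0 to 3
  and from \<open>h\<close> to \<open>h + 1\<close>. The two gaps between them both have length
  \<open>h - 4\<close>, which is \<open>(n - 9) div 2\<close>.\<close>

lemma k_diagonal_width_array: "k_diagonal_width n 9 ((n - 9) div 2) array"
  unfolding k_diagonal_width_def
proof (intro conjI ballI allI impI k_diagonal_array)
  have n: "n = 2 * h + 1" "h \<ge> 5" using n_eq h_eq m_ge by auto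
  then show "9 < n" by simp
  fix r l assume "r \<in> {1..n}" and strip: "empty_strip n array r l"
  then have r: "1 \<le> r" "r \<le> n" by auto
  have l: "1 \<le> l" using strip by (simp add: empty_strip_def)
  \<comment> \<open>Diagonal \<open>i\<close> has residue \<open>i - 1\<close>, so the strip
    occupies the residues \<open>r\<close>, ..., \<open>r + l - 1\<close> modulo
    \<open>n\<close>.\<close>
  have gap: "(r + j) mod n \<notin> set offsets" if "j < l" for j
    using strip that empty_diagonal_iff[of "Suc (r + j)"] by (auto simp: empty_strip_def)
  have first: "(r - 1) mod n \<in> set offsets" and last: "(r + l) mod n \<in> set offsets"
    using strip r filled_diagonal_iff[of r] filled_diagonal_iff[of "Suc (r + l)"]
    by (auto simp: empty_strip_def)
  have "0 \<in> set offsets" by (simp add: set_offsets)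
  then have "r \<noteq> n" using gap[of 0] l by auto
  then have "r - 1 \<in> set offsets" "r \<notin> set offsets"
    using first gap[of 0] l r by auto
  have "Suc (n - 3) = n - 2" "Suc (n - 2) = n - 1" "Suc (n - 1) = n"
    using n by linarith+
  \<comment> \<open>Only 3 and \<open>h + 1\<close> end a run of filled residues;
    \<open>n - 1\<close> is followed by 0.\<close>
  then have "Suc d \<in> set offsets \<or> Suc d = n" if "d \<in> set offsets" "d \<noteq> 3" "d \<noteq> h + 1" for d
    using that unfolding set_offsets by auto
  from this[of "r - 1"] have "r - 1 = 3 \<or> r - 1 = h + 1"
    using \<open>r - 1 \<in> set offsets\<close> \<open>r \<notin> set offsets\<close> \<open>r \<noteq> n\<close> r(1) by auto
  then have "r = 4 \<or> r = h + 2"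
    using r(1) by linarith
  \<comment> \<open>With \<open>e\<close> the next filled residue, the strip can neither run past
    \<open>e\<close> nor stop before it.\<close>
  have len: "l = e - r" if "e \<in> set offsets" "r < e" "e < n" "\<forall>d\<in>set offsets. r \<le> d \<longrightarrow> e \<le> d" for e
  proof -
    have "\<not> e - r < l"
      using gap[of "e - r"] that by auto
    then have "r + l \<le> e" using that by auto
    then have "r + l \<in> set offsets" using last that by auto
    then show ?thesis using that(2,4) \<open>r + l \<le> e\<close> by force
  qed
  have "h + 2 < n - 3" using n by linarith
  show "l = (n - 9) div 2"
    using \<open>r = 4 \<or> r = h + 2\<close>
  proof
    assume "r = 4"
    then have "l = h - r"
      using size_bounds n(2) by (intro len) (auto simp: set_offsets)
    then show ?thesis using n \<open>r = 4\<close> by simp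
  next
    assume "r = h + 2"
    then have "l = n - 3 - r"
      using size_bounds \<open>h + 2 < n - 3\<close> by (intro len) (auto simp: set_offsets)
    then show ?thesis using n \<open>r = h + 2\<close> by simp
  qed
qed

end

theorem proposition4p8:
  fixes n :: nat
  assumes "n \<ge> 11" and "[n = 3] (mod 4)"
  shows "\<exists>A :: int pf_array.
    integer_relative_heffter 9 n 9 A \<and>
    globally_simple (heffter_group 9 n 9) n A \<and>
    k_diagonal_width n 9 ((n - 9) div 2) A"
proof -
  have "n mod 4 = 3" using assms(2) by (simp add: cong_def)
  then interpret circulant_heffter n "n div 4" "2 * (n div 4) + 1"
  proof unfold_locales
    show "n = 4 * (n div 4) + 3" using \<open>n mod 4 = 3\<close> mult_div_mod_eq[of 4 n] by simp
    show "2 \<le> n div 4" using assms(1) \<open>n mod 4 = 3\<close> by presburger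
  qed simp
  show ?thesis
    using integer_relative_heffter_array globally_simple_array k_diagonal_width_array by blast
qed

end
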